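(* Let $V,U_\psi,U_\phi$ be unitaries on $n$ qubits, and for $i\in\{0,1\}^n$ let $|\psi_i\rangle=U_\psi|i\rangle$ and $|\phi_i\rangle=U_\phi|i\rangle$. Given the ability to implement $V$, $U_\psi$ and $U_\phi$, $n$ qubits of quantum memory, and classical randomization, there is an algorithm whose output $(i,j)\in\{0,1\}^n\times\{0,1\}^n$ is distributed according to the probability distribution $p(i,j)=|\langle\psi_j|V|\phi_i\rangle|^2/2^n$.
   Context: $\{|i\rangle\}_{i\in\{0,1\}^n}$ is the computational basis of $(\mathbb C^2)^{\otimes n}$. The operations available to the algorithm are: drawing classical random bits; preparing, on $n$ qubits, a computational basis state $|i\rangle$ that may depend on the classical random bits; applying the given unitaries (the ability to implement a unitary is understood to include its inverse; concretely $V$, $U_\phi$ and $U_\psi^\dagger$ may be applied) to these $n$ qubits; and measuring the $n$ qubits in the computational basis (an outcome $j$ on state $|\chi\rangle$ occurs with probability $|\langle j|\chi\rangle|^2$). *)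

theory Defs
  imports "HOL-Probability.Probability"
begin

text \<open>
  The number of qubits is \<open>n = CARD('n)\<close>. Bit strings are vectors of booleans, and the
  tensor power of \<open>n\<close> qubits is identified with the coordinate space indexed by bit
  strings, so that \<open>ket i\<close> is the computational basis.
\<close>

type_synonym 'n bits = "bool ^ 'n"
type_synonym 'n state = "complex ^ 'n bits"
type_synonym 'n operator = "complex ^ 'n bits ^ 'n bits"

definition ket :: "'n::finite bits \<Rightarrow> 'n state" where
  "ket i = axis i 1"

definition braket :: "'n::finite state \<Rightarrow> 'n state \<Rightarrow> complex" where
  "braket x y = (\<Sum>k\<in>UNIV. cnj (x $ k) * y $ k)"

definition adj :: "'n::finite operator \<Rightarrow> 'n operator" where
  "adj A = (\<chi> k l. cnj (A $ l $ k))"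

definition unitary :: "'n::finite operator \<Rightarrow> bool" where
  "unitary A \<longleftrightarrow> adj A ** A = mat 1 \<and> A ** adj A = mat 1"

text \<open>
  An algorithm refers to the given unitaries only through gate names, so it cannot depend
  on their matrix entries.
\<close>

datatype gate = Gate_V | Gate_Uphi | Gate_Upsi_adj

primrec gate_operator ::
    "'n::finite operator \<Rightarrow> 'n operator \<Rightarrow> 'n operator \<Rightarrow> gate \<Rightarrow> 'n operator" where
  "gate_operator V Upsi Uphi Gate_V = V"
| "gate_operator V Upsi Uphi Gate_Uphi = Uphi"
| "gate_operator V Upsi Uphi Gate_Upsi_adj = adj Upsi"

text \<open>
  The argument of \<open>Prepare\<close> receives the random bits drawn so far; the second component of
  an algorithm computes its output from all random bits and all measurement outcomes. Both
  lists are in chronological order.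
\<close>

datatype 'n instruction =
    Draw_Bit
  | Prepare "bool list \<Rightarrow> ('n::finite) bits"
  | Apply gate
  | Measure

type_synonym ('n, 'r) algorithm =
  "'n instruction list \<times> (bool list \<Rightarrow> 'n bits list \<Rightarrow> 'r)"

type_synonym 'n configuration = "bool list \<times> 'n bits list \<times> 'n state"

text \<open>
  \<open>embed_pmf\<close> is meaningful only for weights summing to one, that is, for unit vectors
  (see \<open>pmf_measurement\<close> below); all states reached under unitary gates are of this kind.
\<close>

definition measurement :: "'n::finite state \<Rightarrow> 'n bits pmf" where
  "measurement x = embed_pmf (\<lambda>j. (cmod (braket (ket j) x))\<^sup>2)"

fun step ::
    "(gate \<Rightarrow> 'n::finite operator) \<Rightarrow> 'n instruction \<Rightarrow> 'n configuration
      \<Rightarrow> 'n configuration pmf" where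
  "step G Draw_Bit (bs, ms, x) = map_pmf (\<lambda>b. (bs @ [b], ms, x)) (bernoulli_pmf (1 / 2))"
| "step G (Prepare f) (bs, ms, x) = return_pmf (bs, ms, ket (f bs))"
| "step G (Apply g) (bs, ms, x) = return_pmf (bs, ms, G g *v x)"
| "step G Measure (bs, ms, x) = map_pmf (\<lambda>j. (bs, ms @ [j], ket j)) (measurement x)"

primrec steps ::
    "(gate \<Rightarrow> 'n::finite operator) \<Rightarrow> 'n instruction list \<Rightarrow> 'n configuration
      \<Rightarrow> 'n configuration pmf" where
  "steps G [] c = return_pmf c"
| "steps G (a # as) c = bind_pmf (step G a c) (steps G as)"

text \<open>The quantum memory initially holds the all-zero basis state.\<close>

definition output_distribution ::
    "(gate \<Rightarrow> 'n::finite operator) \<Rightarrow> ('n, 'r) algorithm \<Rightarrow> 'r pmf" where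
  "output_distribution G A =
     map_pmf (\<lambda>(bs, ms, x). snd A bs ms) (steps G (fst A) ([], [], ket (\<chi> q. False)))"

lemma braket_ket [simp]: "braket (ket j) x = x $ j"
proof -
  have "braket (ket j) x = (\<Sum>k\<in>UNIV. if j = k then x $ k else 0)"
    unfolding braket_def ket_def axis_def by (intro sum.cong) auto
  then show ?thesis by simp
qed

lemma pmf_measurement:
  fixes x :: "'n::finite state"
  assumes "braket x x = 1"
  shows "pmf (measurement x) j = (cmod (braket (ket j) x))\<^sup>2"
proof -
  have "complex_of_real ((cmod (x $ k))\<^sup>2) = cnj (x $ k) * x $ k" for k
    using complex_norm_square[of "x $ k"] by (simp add: mult.commute)
  then have "complex_of_real (\<Sum>k\<in>UNIV. (cmod (x $ k))\<^sup>2) = braket x x"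
    unfolding braket_def of_real_sum by (intro sum.cong refl)
  then have "complex_of_real (\<Sum>k\<in>UNIV. (cmod (x $ k))\<^sup>2) = 1"
    using assms by simp
  then have "(\<Sum>k\<in>UNIV. (cmod (x $ k))\<^sup>2) = 1"
    using of_real_eq_1_iff by blast
  then have "(\<integral>\<^sup>+k. ennreal ((cmod (x $ k))\<^sup>2) \<partial>count_space UNIV) = 1"
    by (simp add: nn_integral_count_space_finite)
  then show ?thesis
    unfolding measurement_def by (subst pmf_embed_pmf) auto
qed

end

theory Submission
  imports Defs
begin

text \<open>
  Draw \<open>n\<close> random bits, so that the string \<open>i\<close> they encode is uniform, prepare \<open>ket i\<close>, apply
  \<open>Uphi\<close>, \<open>V\<close> and \<open>adj Upsi\<close>, and measure. Given \<open>i\<close>, the outcome \<open>j\<close> has amplitude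
  \<open>braket (ket j) (adj Upsi *v (V *v (Uphi *v ket i)))\<close>, and \<open>adj Upsi\<close> moves to the left
  factor as \<open>Upsi\<close>.
\<close>

lemma adj_adj [simp]: "adj (adj A) = A"
  by (simp add: adj_def vec_eq_iff)

lemma unitary_adj: "unitary A \<Longrightarrow> unitary (adj A)"
  by (simp add: unitary_def)

text \<open>The conjugation in \<open>braket\<close> undoes the one in \<open>adj\<close>; what
  remains is an exchange of two finite sums.\<close>

lemma braket_adj_left: "braket (adj A *v x) y = braket x (A *v y)"
proof -
  have "braket (adj A *v x) y = (\<Sum>k\<in>UNIV. \<Sum>l\<in>UNIV. A $ l $ k * cnj (x $ l) * y $ k)"
    by (simp add: braket_def matrix_vector_mult_def adj_def sum_distrib_right)
  also have "\<dots> = (\<Sum>l\<in>UNIV. \<Sum>k\<in>UNIV. A $ l $ k * cnj (x $ l) * y $ k)"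
    by (rule sum.swap)
  also have "\<dots> = braket x (A *v y)"
    by (simp add: braket_def matrix_vector_mult_def sum_distrib_left mult_ac)
  finally show ?thesis .
qed

lemma braket_unitary:
  assumes "unitary A"
  shows "braket (A *v x) (A *v y) = braket x y"
proof -
  have "braket (A *v x) (A *v y) = braket (adj A *v (A *v x)) y"
    by (simp add: braket_adj_left)
  then show ?thesis
    using assms by (simp add: unitary_def matrix_vector_mul_assoc)
qed

lemma steps_append: "steps G (as @ bs) c = bind_pmf (steps G as c) (steps G bs)"
  by (induction as arbitrary: c)
    (auto simp: bind_return_pmf bind_assoc_pmf intro!: bind_pmf_cong)

lemma finite_bool_lists: "finite {cs :: bool list. length cs = m}"
  using finite_lists_length_eq[of "UNIV :: bool set" m] by simp

lemma pmf_of_set_Times: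
  assumes "finite A" "A \<noteq> {}" "finite B" "B \<noteq> {}"
  shows "pmf_of_set (A \<times> B) = pair_pmf (pmf_of_set A) (pmf_of_set B)"
proof (rule pmf_eqI)
  fix z :: "'a \<times> 'b"
  show "pmf (pmf_of_set (A \<times> B)) z = pmf (pair_pmf (pmf_of_set A) (pmf_of_set B)) z"
    using assms by (cases z) (simp add: pmf_pair card_cartesian_product indicator_times)
qed

text \<open>Consing is a bijection from pairs of a bit and a shorter list. The head is split off
  because it plays the part of the bit drawn first.\<close>

lemma pmf_of_set_bool_lists_Suc:
  "pmf_of_set {cs :: bool list. length cs = Suc m} =
     bind_pmf (bernoulli_pmf (1 / 2)) (\<lambda>b. map_pmf ((#) b) (pmf_of_set {cs. length cs = m}))"
proof -
  let ?L = "{cs :: bool list. length cs = m}"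
  have bij: "bij_betw (\<lambda>(b, cs). b # cs) (UNIV \<times> ?L) {cs. length cs = Suc m}"
    by (rule bij_betwI[where g = "\<lambda>cs. (hd cs, tl cs)"]) (auto simp: length_Suc_conv)
  have "pmf_of_set {cs :: bool list. length cs = Suc m} =
      map_pmf (\<lambda>(b, cs). b # cs) (pmf_of_set (UNIV \<times> ?L))"
    by (rule map_pmf_of_set_bij_betw[OF bij, symmetric])
      (simp_all add: finite_bool_lists Ex_list_of_length)
  also have "pmf_of_set ((UNIV :: bool set) \<times> ?L) = pair_pmf (pmf_of_set UNIV) (pmf_of_set ?L)"
    by (rule pmf_of_set_Times) (simp_all add: finite_bool_lists Ex_list_of_length)
  finally show ?thesis
    by (simp add: bernoulli_pmf_half_conv_pmf_of_set pair_pmf_def map_bind_pmf bind_return_pmf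
        map_pmf_def bind_assoc_pmf)
qed

lemma steps_draw_bits:
  "steps G (replicate m Draw_Bit) (bs, ms, x) =
     map_pmf (\<lambda>cs. (bs @ cs, ms, x)) (pmf_of_set {cs. length cs = m})"
\<comment> \<open>The first draw turns \<open>bs\<close> into \<open>bs @ [b]\<close>, so the
  induction hypothesis is needed for this longer prefix.\<close>
proof (induction m arbitrary: bs)
  case 0
  then show ?case by (simp add: pmf_of_set_singleton)
next
  case (Suc m)
  then show ?case
    by (simp add: pmf_of_set_bool_lists_Suc bind_map_pmf map_bind_pmf pmf.map_comp o_def)
qed

text \<open>
  The type \<open>'n\<close> carries no order, so identifying lists with bit strings requires a choice of
  an enumeration \<open>h\<close>.
\<close>

lemma bij_betw_bits_of_list:
  fixes h :: "'n::finite \<Rightarrow> nat"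
  assumes "bij_betw h UNIV {..<CARD('n)}"
  shows "bij_betw (\<lambda>bs. \<chi> q. bs ! h q) {bs :: bool list. length bs = CARD('n)} UNIV"
proof (rule bij_betwI[where g = "\<lambda>v. map (\<lambda>k. v $ inv_into UNIV h k) [0..<CARD('n)]"])
  fix bs :: "bool list"
  assume "bs \<in> {bs. length bs = CARD('n)}"
  then show "map (\<lambda>k. (\<chi> q. bs ! h q) $ inv_into UNIV h k) [0..<CARD('n)] = bs"
    using bij_betw_inv_into_right[OF assms] by (auto intro!: nth_equalityI)
next
  fix v :: "bool ^ 'n"
  have "h q < CARD('n)" for q
    using bij_betwE[OF assms] by auto
  then show "(\<chi> q. map (\<lambda>k. v $ inv_into UNIV h k) [0..<CARD('n)] ! h q) = v"
    using bij_betw_inv_into_left[OF assms] by (simp add: vec_eq_iff)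
qed auto

text \<open>The tag reveals which branch was taken, so in the mixture over \<open>p\<close> only the
  branch \<open>i\<close> contributes to \<open>(i, j)\<close>.\<close>

lemma pmf_bind_tagged:
  "pmf (bind_pmf p (\<lambda>i. map_pmf (Pair i) (q i))) (i, j) = pmf p i * pmf (q i) j"
proof -
  have "pmf (map_pmf (Pair i') (q i')) (i, j) = indicator {i} i' * pmf (q i) j" for i'
  proof (cases "i' = i")
    case True
    then show ?thesis
      by (simp add: pmf_map_inj' inj_on_def)
  next
    case False
    then show ?thesis
      by (auto intro: pmf_map_outside)
  qed
  then show ?thesis
    by (simp add: pmf_bind measure_pmf_single)
qed

theorem theorem5:
  "\<exists>A :: ('n::finite, 'n bits \<times> 'n bits) algorithm.
     \<forall>V Upsi Uphi :: 'n operator.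
       unitary V \<and> unitary Upsi \<and> unitary Uphi \<longrightarrow>
         (\<forall>i j. pmf (output_distribution (gate_operator V Upsi Uphi) A) (i, j) =
            (cmod (braket (Upsi *v ket j) (V *v (Uphi *v ket i))))\<^sup>2 / 2 ^ CARD('n))"
proof -
  obtain h :: "'n \<Rightarrow> nat" where h: "bij_betw h UNIV {..<CARD('n)}"
    using ex_bij_betw_finite_nat[of "UNIV :: 'n set"] by (auto simp: atLeast0LessThan)
  define dec :: "bool list \<Rightarrow> 'n bits" where "dec = (\<lambda>bs. \<chi> q. bs ! h q)"
  \<comment> \<open>\<open>A\<close> is fixed before the unitaries and depends only on the
    enumeration \<open>h\<close>. The output decodes the recorded bits again to recover the prepared
    \<open>i\<close>; \<open>hd ms\<close> is the single measurement outcome.\<close>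
  define A :: "('n, 'n bits \<times> 'n bits) algorithm" where
    "A = (replicate CARD('n) Draw_Bit @
            [Prepare dec, Apply Gate_Uphi, Apply Gate_V, Apply Gate_Upsi_adj, Measure],
          \<lambda>bs ms. (dec bs, hd ms))"
  have dec: "map_pmf dec (pmf_of_set {cs. length cs = CARD('n)}) = pmf_of_set UNIV"
    unfolding dec_def
    by (rule map_pmf_of_set_bij_betw[OF bij_betw_bits_of_list[OF h]])
      (simp_all add: finite_bool_lists Ex_list_of_length)
  have "pmf (output_distribution (gate_operator V Upsi Uphi) A) (i, j) =
      (cmod (braket (Upsi *v ket j) (V *v (Uphi *v ket i))))\<^sup>2 / 2 ^ CARD('n)"
    if "unitary V" "unitary Upsi" "unitary Uphi" for V Upsi Uphi :: "'n operator" and i j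
  proof -
    define final where "final = (\<lambda>i. adj Upsi *v (V *v (Uphi *v ket i)))"
    have "output_distribution (gate_operator V Upsi Uphi) A =
        bind_pmf (map_pmf dec (pmf_of_set {cs. length cs = CARD('n)}))
          (\<lambda>i. map_pmf (Pair i) (measurement (final i)))"
      by (simp add: output_distribution_def A_def final_def steps_append steps_draw_bits
          bind_map_pmf map_bind_pmf bind_return_pmf map_pmf_def[of "Pair i" for i] pmf.map_comp o_def)
    \<comment> \<open>By \<open>dec\<close> the tag is uniform on all \<open>2 ^ CARD('n)\<close>
      bit strings, whence the denominator.\<close>
    then have "pmf (output_distribution (gate_operator V Upsi Uphi) A) (i, j) =
        pmf (measurement (final i)) j / 2 ^ CARD('n)"
      by (simp add: dec pmf_bind_tagged)
    \<comment> \<open>Normalization gives \<open>measurement\<close> its intended meaning. The three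
      unitaries cancel and leave \<open>ket i $ i = 1\<close>; \<open>ket_def\<close> is unfolded
      only then, so that \<open>braket_ket\<close> can match first.\<close>
    also have "braket (final i) (final i) = 1"
      using that by (simp add: final_def braket_unitary unitary_adj) (simp add: ket_def)
    then have "pmf (measurement (final i)) j = (cmod (braket (ket j) (final i)))\<^sup>2"
      by (rule pmf_measurement)
    \<comment> \<open>This is \<open>braket_adj_left\<close> for \<open>adj Upsi\<close>, read from
      right to left.\<close>
    also have "braket (ket j) (final i) = braket (Upsi *v ket j) (V *v (Uphi *v ket i))"
      unfolding final_def by (metis adj_adj braket_adj_left)
    finally show ?thesis .
  qed
  then show ?thesis by blast
qed

end
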